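(* Let $B$ be a discrete abelian group, $\alpha\in\mathrm{Aut}(B)$, and let $\mu$ be the normalized Haar measure on the compact group $K=\hat B$. If the set of periodic points of $\hat\alpha$ has $\mu$-measure zero, then there is no measurable subset $M$ of $K$ such that $M$ intersects $\mathcal{O}(\chi)$ in exactly one point for $\mu$-almost every $\chi\in K$.
   Context: $K=\hat B$ is the Pontryagin dual of $B$, and $\hat\alpha\in\mathrm{Aut}(K)$ is the dual automorphism $(\hat\alpha\chi)(b)=\chi(\alpha(b))$. A point $\chi\in K$ is periodic if $\hat\alpha^p(\chi)=\chi$ for some integer $p\ge1$. The orbit of $\chi$ is $\mathcal{O}(\chi)=\{\hat\alpha^k(\chi)\mid k\in\mathbb{Z}\}$. *)

theory Defs
  imports "HOL-Analysis.Analysis" "HOL-Algebra.Bij" "HOL-Algebra.Coset"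
begin

definition circle_group :: "complex monoid" where
  "circle_group = \<lparr>carrier = sphere 0 1, mult = (*), one = 1\<rparr>"

(* B carries the discrete topology, so every homomorphism to the circle is continuous.
   Characters are extensional (undefined off the carrier of B), so that two characters are
   equal as soon as they agree on B. *)
definition dual_group :: "('a, 'm) monoid_scheme \<Rightarrow> ('a \<Rightarrow> complex) monoid" where
  "dual_group B =
    \<lparr>carrier = hom B circle_group \<inter> extensional (carrier B),
     mult = (\<lambda>\<phi> \<psi>. \<lambda>b\<in>carrier B. \<phi> b * \<psi> b),
     one = (\<lambda>b\<in>carrier B. 1)\<rparr>"

(* The compact subsets of a discrete group are the finite ones, so the compact-open topology on
   the dual is the topology of pointwise convergence. *)
definition dual_topology :: "('a, 'm) monoid_scheme \<Rightarrow> ('a \<Rightarrow> complex) topology" where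
  "dual_topology B =
    subtopology (product_topology (\<lambda>_. euclidean) (carrier B)) (carrier (dual_group B))"

(* Left Haar measure, as a Radon measure on the Borel sets of the topological group (G, T).
   Regularity is part of the definition: when B is uncountable, the Borel sets of the dual need
   not be generated by a countable family, and regularity is not automatic. *)
definition haar_measure ::
    "('g, 'm) monoid_scheme \<Rightarrow> 'g topology \<Rightarrow> 'g measure \<Rightarrow> bool" where
  "haar_measure G T \<mu> \<longleftrightarrow>
     space \<mu> = topspace T \<and>
     sets \<mu> = sigma_sets (topspace T) {U. openin T U} \<and>
     emeasure \<mu> (space \<mu>) \<noteq> 0 \<and>
     (\<forall>x\<in>carrier G. \<forall>A\<in>sets \<mu>. emeasure \<mu> (x <#\<^bsub>G\<^esub> A) = emeasure \<mu> A) \<and>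
     (\<forall>C. compactin T C \<longrightarrow> emeasure \<mu> C < \<infinity>) \<and>
     (\<forall>A\<in>sets \<mu>. emeasure \<mu> A = (INF U\<in>{U. openin T U \<and> A \<subseteq> U}. emeasure \<mu> U)) \<and>
     (\<forall>U. openin T U \<longrightarrow>
        emeasure \<mu> U = (SUP C\<in>{C. compactin T C \<and> C \<subseteq> U}. emeasure \<mu> C))"

definition normalized_haar_measure ::
    "('g, 'm) monoid_scheme \<Rightarrow> 'g topology \<Rightarrow> 'g measure \<Rightarrow> bool" where
  "normalized_haar_measure G T \<mu> \<longleftrightarrow> haar_measure G T \<mu> \<and> emeasure \<mu> (space \<mu>) = 1"

definition dual_aut ::
    "('a, 'm) monoid_scheme \<Rightarrow> ('a \<Rightarrow> 'a) \<Rightarrow> ('a \<Rightarrow> complex) \<Rightarrow> ('a \<Rightarrow> complex)" where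
  "dual_aut B \<alpha> = (\<lambda>\<phi>\<in>carrier (dual_group B). \<lambda>b\<in>carrier B. \<phi> (\<alpha> b))"

(* Integer powers are taken in the automorphism group of G. *)
definition periodic_points :: "('g, 'm) monoid_scheme \<Rightarrow> ('g \<Rightarrow> 'g) \<Rightarrow> 'g set" where
  "periodic_points G f =
    {x \<in> carrier G. \<exists>p::int. p \<ge> 1 \<and> (f [^]\<^bsub>AutoGroup G\<^esub> p) x = x}"

definition aut_orbit :: "('g, 'm) monoid_scheme \<Rightarrow> ('g \<Rightarrow> 'g) \<Rightarrow> 'g \<Rightarrow> 'g set" where
  "aut_orbit G f x = {(f [^]\<^bsub>AutoGroup G\<^esub> k) x | k::int. True}"

lemma topspace_dual_topology: "topspace (dual_topology B) = carrier (dual_group B)"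
  by (auto simp: dual_topology_def dual_group_def PiE_def)

lemma comm_group_dual_group:
  assumes "comm_group B"
  shows "comm_group (dual_group B)"
proof -
  interpret B: comm_group B by fact
  show ?thesis
  proof (rule comm_groupI)
    fix \<phi> \<psi>
    assume "\<phi> \<in> carrier (dual_group B)" "\<psi> \<in> carrier (dual_group B)"
    then show "\<phi> \<otimes>\<^bsub>dual_group B\<^esub> \<psi> \<in> carrier (dual_group B)"
      by (auto simp: dual_group_def hom_def circle_group_def Pi_iff norm_mult)
  next
    fix \<phi>
    assume \<phi>: "\<phi> \<in> carrier (dual_group B)"
    define \<psi> where "\<psi> = (\<lambda>b\<in>carrier B. inverse (\<phi> b))"
    have "\<phi> b \<noteq> 0" if "b \<in> carrier B" for b
      using \<phi> that by (force simp: dual_group_def hom_def circle_group_def Pi_iff)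
    then have "\<psi> \<otimes>\<^bsub>dual_group B\<^esub> \<phi> = \<one>\<^bsub>dual_group B\<^esub>"
      by (auto simp: dual_group_def \<psi>_def fun_eq_iff restrict_def)
    moreover have "\<psi> \<in> carrier (dual_group B)"
      using \<phi> by (auto simp: dual_group_def hom_def circle_group_def Pi_iff \<psi>_def norm_inverse)
    ultimately show "\<exists>\<psi>\<in>carrier (dual_group B). \<psi> \<otimes>\<^bsub>dual_group B\<^esub> \<phi> = \<one>\<^bsub>dual_group B\<^esub>"
      by blast
  qed (auto simp: dual_group_def hom_def circle_group_def fun_eq_iff restrict_def extensional_def)
qed

lemma dual_aut_in_auto:
  assumes "comm_group B" and \<alpha>: "\<alpha> \<in> auto B"
  shows "dual_aut B \<alpha> \<in> auto (dual_group B)"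
proof -
  interpret B: comm_group B by fact
  let ?K = "carrier (dual_group B)"
  define \<beta> where "\<beta> = restrict (inv_into (carrier B) \<alpha>) (carrier B)"
  have bij: "bij_betw \<alpha> (carrier B) (carrier B)"
    using \<alpha> by (auto simp: auto_def Bij_def)
  have \<beta>: "\<beta> \<in> hom B B"
    unfolding \<beta>_def using \<alpha> by (intro B.restrict_inv_into_hom) (auto simp: auto_def)
  have \<alpha>': "\<alpha> \<in> hom B B"
    using \<alpha> by (auto simp: auto_def)
  have \<alpha>\<beta>: "\<alpha> (\<beta> b) = b" "\<beta> (\<alpha> b) = b" if "b \<in> carrier B" for b
    using bij that bij_betwE[OF bij]
    by (auto simp: \<beta>_def bij_betw_inv_into_right bij_betw_inv_into_left)
  have closed: "dual_aut B \<gamma> \<phi> \<in> ?K" if "\<gamma> \<in> hom B B" "\<phi> \<in> ?K" for \<gamma> \<phi>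
    using that by (auto simp: dual_aut_def dual_group_def hom_def Pi_iff)
  have inv: "dual_aut B \<gamma> (dual_aut B \<delta> \<phi>) = \<phi>"
    if "\<gamma> \<in> hom B B" "\<delta> \<in> hom B B" "\<And>b. b \<in> carrier B \<Longrightarrow> \<delta> (\<gamma> b) = b" "\<phi> \<in> ?K" for \<gamma> \<delta> \<phi>
  proof
    fix b
    have "\<phi> \<in> extensional (carrier B)"
      using that by (simp add: dual_group_def)
    moreover have "\<gamma> b \<in> carrier B" if "b \<in> carrier B"
      using that \<open>\<gamma> \<in> hom B B\<close> by (auto simp: hom_def)
    ultimately show "dual_aut B \<gamma> (dual_aut B \<delta> \<phi>) b = \<phi> b"
      using that closed[of \<delta> \<phi>]
      by (cases "b \<in> carrier B") (auto simp: dual_aut_def extensional_def)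
  qed
  have "bij_betw (dual_aut B \<alpha>) ?K ?K"
    by (rule bij_betw_byWitness[where f' = "dual_aut B \<beta>"])
       (use inv closed \<alpha>' \<beta> \<alpha>\<beta> in auto)
  moreover have "dual_aut B \<alpha> \<in> hom (dual_group B) (dual_group B)"
  proof (rule homI)
    fix \<phi> \<psi>
    assume "\<phi> \<in> ?K" "\<psi> \<in> ?K"
    moreover from this have "\<phi> \<otimes>\<^bsub>dual_group B\<^esub> \<psi> \<in> ?K"
      using comm_group_dual_group[OF assms(1)]
      by (simp add: comm_group_def group_def monoid.m_closed)
    moreover have "\<alpha> b \<in> carrier B" if "b \<in> carrier B" for b
      using that \<alpha>' by (auto simp: hom_def)
    ultimately show "dual_aut B \<alpha> (\<phi> \<otimes>\<^bsub>dual_group B\<^esub> \<psi>)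
        = dual_aut B \<alpha> \<phi> \<otimes>\<^bsub>dual_group B\<^esub> dual_aut B \<alpha> \<psi>"
      by (auto simp: dual_aut_def dual_group_def fun_eq_iff restrict_def)
  qed (use closed \<alpha>' in auto)
  ultimately show ?thesis
    by (auto simp: auto_def Bij_def dual_aut_def)
qed

end

theory Submission
  imports Defs "HOL-Algebra.Generated_Groups"
begin

text \<open>
  The automorphism \<open>T\<close> of the compact dual \<open>K\<close> and all its powers preserve the Haar probability
  measure \<open>\<mu>\<close>. Suppose that \<open>M\<close> meets almost every orbit exactly once. Almost every point is not
  periodic, so the iterates of such a point are pairwise distinct and exactly one of them lies in
  \<open>M\<close>. In other words the preimages of \<open>M\<close> under the powers of \<open>T\<close> partition \<open>K\<close> up to a null set.
  They all have the measure of \<open>M\<close>, and there are infinitely many of them: if that measure is zero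
  they cannot cover \<open>K\<close>, and if it is positive finitely many of them already exceed the total mass.
  This counting is lemma \<open>no_measurable_transversal\<close>.

  What needs the group is the invariance of \<open>\<mu>\<close> under \<open>T\<close>, lemma \<open>distr_continuous_auto\<close>. It rests on
  Fourier analysis. The integral of a continuous character of \<open>K\<close> is 1 or 0 according to whether the
  character is trivial, by translation invariance, and composition with the surjection \<open>T\<close> neither
  creates nor destroys triviality. Hence \<open>f\<close> and \<open>f \<circ> T\<close> have the same integral for every
  trigonometric polynomial \<open>f\<close>, by the Stone-Weierstrass theorem for every continuous \<open>f\<close>, and by
  Urysohn's lemma and regularity the same holds for the indicator function of a Borel set. The
  evaluations at elements of \<open>B\<close> are continuous characters, and they separate the points of \<open>K\<close>
  because distinct functions differ somewhere.

  Continuous automorphisms of \<open>K\<close> form a group, as \<open>K\<close> is compact and Hausdorff, so the invariance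
  covers the negative powers of \<open>T\<close> as well.
\<close>

section \<open>The dual group as a compact Hausdorff subspace\<close>

text \<open>
  A copy of the function type with the topology of pointwise convergence. It is in class \<open>t2_space\<close>
  for every domain, whereas the arity of the function type itself in this class comes from the
  metric on countable products. The Stone-Weierstrass theorem, which is about compact subsets of a
  type in \<open>t2_space\<close>, is carried over to sets of functions along the homeomorphism \<open>Pw\<close>.
\<close>

typedef ('a, 'b) pointwise = "UNIV :: ('a \<Rightarrow> 'b) set"
  morphisms apply_pw Pw ..

declare apply_pw_inverse [simp] Pw_inverse [OF UNIV_I, simp]

instantiation pointwise :: (type, topological_space) topological_space
begin

definition open_pointwise :: "('a, 'b) pointwise set \<Rightarrow> bool" where
  "open_pointwise U \<longleftrightarrow> open (Pw -` U)"

instance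
  by standard (auto simp: open_pointwise_def vimage_Int vimage_Union)

end

lemma continuous_on_Pw: "continuous_on S Pw"
  by (rule continuous_on_subset[of UNIV])
     (auto simp: continuous_on_open_vimage open_pointwise_def)

lemma continuous_on_apply_pw: "continuous_on S apply_pw"
  by (rule continuous_on_subset[of UNIV])
     (auto simp: continuous_on_open_vimage open_pointwise_def vimage_def)

instance pointwise :: (type, t2_space) t2_space
proof
  fix f g :: "('a, 'b) pointwise"
  assume "f \<noteq> g"
  then have "apply_pw f \<noteq> apply_pw g"
    by (simp add: apply_pw_inject)
  then obtain a where "apply_pw f a \<noteq> apply_pw g a"
    by (auto simp: fun_eq_iff)
  then obtain U V where UV: "open U" "open V" "apply_pw f a \<in> U" "apply_pw g a \<in> V" "U \<inter> V = {}"
    using hausdorff[of "apply_pw f a" "apply_pw g a"] by blast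
  have "continuous_on UNIV (\<lambda>h. apply_pw h a)"
    by (rule continuous_on_compose2[OF continuous_on_product_coordinates continuous_on_apply_pw]) simp
  then have "open ((\<lambda>h. apply_pw h a) -` W)" if "open W" for W :: "'b set"
    using that by (rule open_vimage[rotated])
  moreover have "(\<lambda>h. apply_pw h a) -` U \<inter> (\<lambda>h. apply_pw h a) -` V = {}"
    using UV(5) by blast
  moreover have "f \<in> (\<lambda>h. apply_pw h a) -` U" "g \<in> (\<lambda>h. apply_pw h a) -` V"
    using UV(3,4) by simp_all
  ultimately show "\<exists>U V. open U \<and> open V \<and> f \<in> U \<and> g \<in> V \<and> U \<inter> V = {}"
    using UV(1,2) by meson
qed

lemma Stone_Weierstrass_pointwise:
  fixes S :: "('a \<Rightarrow> 'b::t2_space) set" and P :: "(('a \<Rightarrow> 'b) \<Rightarrow> real) \<Rightarrow> bool"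
  assumes "compact S"
    and const: "\<And>c. P (\<lambda>_. c)"
    and cont: "\<And>g. P g \<Longrightarrow> continuous_on S g"
    and add: "\<And>g h. P g \<Longrightarrow> P h \<Longrightarrow> P (\<lambda>x. g x + h x)"
    and mult: "\<And>g h. P g \<Longrightarrow> P h \<Longrightarrow> P (\<lambda>x. g x * h x)"
    and separating: "\<And>x y. \<lbrakk>x \<in> S; y \<in> S; x \<noteq> y\<rbrakk> \<Longrightarrow> \<exists>g. P g \<and> g x \<noteq> g y"
    and "continuous_on S f" "0 < e"
  shows "\<exists>g. P g \<and> (\<forall>x\<in>S. \<bar>f x - g x\<bar> < e)"
proof -
  have transfer: "continuous_on (Pw ` S) (\<lambda>x. g (apply_pw x))" if "continuous_on S g"
    for g :: "('a \<Rightarrow> 'b) \<Rightarrow> real"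
    using that by (auto intro: continuous_on_compose2[OF _ continuous_on_apply_pw])
  have "\<exists>g. P (\<lambda>x. g (Pw x)) \<and> (\<forall>x\<in>Pw ` S. \<bar>f (apply_pw x) - g x\<bar> < e)"
  proof (rule Stone_Weierstrass_HOL)
    show "compact (Pw ` S)"
      using assms(1) by (intro compact_continuous_image continuous_on_Pw)
    show "continuous_on (Pw ` S) g" if "P (\<lambda>x. g (Pw x))" for g
      using transfer[OF cont[OF that]] by simp
    show "\<exists>g. P (\<lambda>x. g (Pw x)) \<and> g x \<noteq> g y" if "x \<in> Pw ` S \<and> y \<in> Pw ` S \<and> x \<noteq> y" for x y
    proof -
      from that have "apply_pw x \<in> S" "apply_pw y \<in> S" "apply_pw x \<noteq> apply_pw y"
        by (auto simp: apply_pw_inject)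
      then obtain g where "P g" "g (apply_pw x) \<noteq> g (apply_pw y)"
        using separating by blast
      then show ?thesis
        by (intro exI[of _ "\<lambda>x. g (apply_pw x)"]) auto
    qed
  qed (use assms transfer in auto)
  then obtain g where "P (\<lambda>x. g (Pw x))" "\<forall>x\<in>Pw ` S. \<bar>f (apply_pw x) - g x\<bar> < e"
    by blast
  then show ?thesis
    by (intro exI[of _ "\<lambda>x. g (Pw x)"]) auto
qed

lemma continuous_on_evaluation:
  "continuous_on S (\<lambda>\<phi>. \<phi> b :: 'b::topological_space)"
  by (rule continuous_on_subset[OF continuous_on_product_coordinates]) simp

text \<open>
  Off the carrier of \<open>B\<close> all characters take the same value, so the coordinates there contribute
  nothing to the topology. The dual can therefore be treated as a subset of the topological space
  of all functions, where the type class lemmas on continuity, compactness and Borel sets apply.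
\<close>

lemma dual_topology_eq_top_of_set:
  "dual_topology B = top_of_set (carrier (dual_group B))"
proof -
  let ?K = "carrier (dual_group B)"
  have "continuous_map (dual_topology B) (top_of_set ?K) (\<lambda>\<phi>. \<phi>)"
    unfolding continuous_map_in_subtopology
  proof
    have "continuous_map (dual_topology B) euclidean (\<lambda>\<phi>. \<phi> b)" for b
    proof (cases "b \<in> carrier B")
      case True
      then show ?thesis
        unfolding dual_topology_def
        by (intro continuous_map_from_subtopology continuous_map_product_projection)
    next
      case False
      have "continuous_map (dual_topology B) euclidean (\<lambda>_. undefined :: complex)"
        by (intro continuous_map_const[THEN iffD2]) simp
      with False show ?thesis
        by (elim continuous_map_eq) (simp add: topspace_dual_topology dual_group_def extensional_def)
    qed
    then show "continuous_map (dual_topology B) euclidean (\<lambda>\<phi>. \<phi>)"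
      by (simp flip: euclidean_product_topology add: continuous_map_componentwise_UNIV)
  qed (auto simp: topspace_dual_topology)
  moreover have "continuous_map (top_of_set ?K) (dual_topology B) (\<lambda>\<phi>. \<phi>)"
    unfolding dual_topology_def continuous_map_in_subtopology
    by (auto simp: continuous_map_componentwise continuous_on_evaluation dual_group_def)
  ultimately have "homeomorphic_maps (dual_topology B) (top_of_set ?K) id id"
    by (simp add: homeomorphic_maps_def id_def)
  then show ?thesis
    by (simp add: homeomorphic_maps_id)
qed

text \<open>
  Tychonoff's theorem: the dual is the subset of a product of circles and singletons that is cut out
  by the closed conditions of being multiplicative.
\<close>

lemma compact_dual_group: "compact (carrier (dual_group B))"
proof -
  let ?P = "PiE UNIV (\<lambda>b. if b \<in> carrier B then sphere (0::complex) 1 else {undefined})"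
  let ?H = "\<lambda>a b. {\<phi> :: 'a \<Rightarrow> complex. \<phi> (a \<otimes>\<^bsub>B\<^esub> b) = \<phi> a * \<phi> b}"
  have "compactin (product_topology (\<lambda>_. euclidean) UNIV) ?P"
    by (subst compactin_PiE) auto
  then have "compact ?P"
    by (simp add: euclidean_product_topology)
  moreover have "closed (\<Inter>a\<in>carrier B. \<Inter>b\<in>carrier B. ?H a b)"
    by (intro closed_INT ballI closed_Collect_eq continuous_intros continuous_on_product_coordinates)
  moreover have "carrier (dual_group B) = ?P \<inter> (\<Inter>a\<in>carrier B. \<Inter>b\<in>carrier B. ?H a b)"
    by (auto simp: dual_group_def hom_def circle_group_def extensional_def PiE_iff Pi_iff
        split: if_splits)
  ultimately show ?thesis
    by (simp add: compact_Int_closed)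
qed

lemma Hausdorff_space_euclidean_fun:
  "Hausdorff_space (euclidean :: ('a \<Rightarrow> 'b::metric_space) topology)"
proof -
  have "Hausdorff_space (product_topology (\<lambda>_::'a. euclidean :: 'b topology) UNIV)"
    by (simp add: Hausdorff_space_product_topology)
  then show ?thesis
    by (simp add: euclidean_product_topology)
qed

lemma closed_dual_group: "closed (carrier (dual_group B))"
  using compactin_imp_closedin[OF Hausdorff_space_euclidean_fun, of "carrier (dual_group B)"]
  by (simp add: compact_dual_group)

section \<open>Trigonometric polynomials\<close>

text \<open>
  The complex span of the continuous multiplicative functions on \<open>G\<close>. On a compact group these are
  the characters and the zero function.
\<close>

inductive trig_poly :: "('g::topological_space, 'm) monoid_scheme \<Rightarrow> ('g \<Rightarrow> complex) \<Rightarrow> bool"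
  for G where
  character: "\<lbrakk>continuous_on (carrier G) \<xi>;
      \<forall>x\<in>carrier G. \<forall>y\<in>carrier G. \<xi> (x \<otimes>\<^bsub>G\<^esub> y) = \<xi> x * \<xi> y\<rbrakk>
    \<Longrightarrow> trig_poly G (\<lambda>x. c * \<xi> x)"
| add: "\<lbrakk>trig_poly G f; trig_poly G g\<rbrakk> \<Longrightarrow> trig_poly G (\<lambda>x. f x + g x)"

lemma trig_poly_const: "trig_poly G (\<lambda>_. c)"
  using trig_poly.character[of G "\<lambda>_. 1" c] by simp

lemma continuous_on_trig_poly: "trig_poly G f \<Longrightarrow> continuous_on (carrier G) f"
  by (induction rule: trig_poly.induct) (auto intro!: continuous_intros)

lemma trig_poly_mult:
  assumes "trig_poly G f" "trig_poly G g"
  shows "trig_poly G (\<lambda>x. f x * g x)"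
  using assms
proof (induction arbitrary: g rule: trig_poly.induct)
  case (character \<xi> c)
  from character(3,1,2) show ?case
  proof (induction rule: trig_poly.induct)
    case (character \<eta> d)
    then have "trig_poly G (\<lambda>x. c * d * (\<xi> x * \<eta> x))"
      by (intro trig_poly.character continuous_intros) auto
    then show ?case
      by (simp add: mult_ac)
  next
    case (add f g)
    then have "trig_poly G (\<lambda>x. c * \<xi> x * f x + c * \<xi> x * g x)"
      by (intro trig_poly.add) auto
    then show ?case
      by (simp add: algebra_simps)
  qed
next
  case (add f1 f2)
  then have "trig_poly G (\<lambda>x. f1 x * g x + f2 x * g x)"
    by (intro trig_poly.add) auto
  then show ?case
    by (simp add: algebra_simps)
qed

lemma trig_poly_evaluation:
  assumes "b \<in> carrier B"
  shows "trig_poly (dual_group B) (\<lambda>\<phi>. c * \<phi> b)"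
  by (rule trig_poly.character)
     (use assms in \<open>auto simp: dual_group_def continuous_on_evaluation\<close>)

text \<open>
  This makes the real and the imaginary part of an evaluation trigonometric polynomials, as
  Stone-Weierstrass for real functions requires.
\<close>

lemma (in group) dual_group_inv_eq_cnj:
  assumes "\<phi> \<in> carrier (dual_group G)" "b \<in> carrier G"
  shows "\<phi> (inv b) = cnj (\<phi> b)"
proof -
  have hom: "\<phi> x \<noteq> 0" "norm (\<phi> x) = 1" "\<phi> (x \<otimes> y) = \<phi> x * \<phi> y"
    if "x \<in> carrier G" "y \<in> carrier G" for x y
    using assms that by (force simp: dual_group_def hom_def circle_group_def Pi_iff)+
  have "\<phi> \<one> = 1"
    using hom[of \<one> \<one>] by simp
  then have "\<phi> b * \<phi> (inv b) = 1"
    using hom(3)[of b "inv b"] assms by simp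
  moreover have "\<phi> b * cnj (\<phi> b) = 1"
    using hom(2)[of b b] assms by (simp add: complex_norm_square[symmetric])
  ultimately show ?thesis
    using hom(1)[of b b] assms by (metis mult_left_cancel)
qed

text \<open>
  Stone-Weierstrass, applied to the real functions that agree on the dual with a trigonometric
  polynomial. Agreement on the dual alone is the right notion: off the dual the conjugate of an
  evaluation is no longer an evaluation at the inverse.
\<close>

lemma (in group) trig_poly_dense:
  assumes "continuous_on (carrier (dual_group G)) f" "0 < e"
  obtains h where "trig_poly (dual_group G) h"
    "\<And>\<phi>. \<phi> \<in> carrier (dual_group G) \<Longrightarrow> norm (h \<phi> - complex_of_real (f \<phi>)) < e"
proof -
  let ?K = "carrier (dual_group G)"
  let ?P = "\<lambda>g :: ('a \<Rightarrow> complex) \<Rightarrow> real.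
    \<exists>h. trig_poly (dual_group G) h \<and> (\<forall>\<phi>\<in>?K. h \<phi> = complex_of_real (g \<phi>))"
  have "\<exists>g. ?P g \<and> (\<forall>\<phi>\<in>?K. \<bar>f \<phi> - g \<phi>\<bar> < e)"
  proof (rule Stone_Weierstrass_pointwise[OF compact_dual_group])
    show "?P (\<lambda>_. c)" for c
      using trig_poly_const by blast
  next
    fix g assume "?P g"
    then obtain h where h: "trig_poly (dual_group G) h" "\<And>\<phi>. \<phi> \<in> ?K \<Longrightarrow> h \<phi> = complex_of_real (g \<phi>)"
      by blast
    have "continuous_on ?K (\<lambda>\<phi>. Re (h \<phi>))"
      by (intro continuous_on_Re continuous_on_trig_poly h(1))
    then show "continuous_on ?K g"
      by (rule continuous_on_eq) (simp add: h(2))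
  next
    fix g1 g2 assume "?P g1" "?P g2"
    then obtain h1 h2 where "trig_poly (dual_group G) h1" "trig_poly (dual_group G) h2"
      "\<forall>\<phi>\<in>?K. h1 \<phi> = complex_of_real (g1 \<phi>)" "\<forall>\<phi>\<in>?K. h2 \<phi> = complex_of_real (g2 \<phi>)"
      by blast
    then show "?P (\<lambda>\<phi>. g1 \<phi> + g2 \<phi>)" "?P (\<lambda>\<phi>. g1 \<phi> * g2 \<phi>)"
      by (intro exI[of _ "\<lambda>\<phi>. h1 \<phi> + h2 \<phi>"] exI[of _ "\<lambda>\<phi>. h1 \<phi> * h2 \<phi>"];
          simp add: trig_poly.add trig_poly_mult)+
  next
    fix \<phi> \<psi> assume K: "\<phi> \<in> ?K" "\<psi> \<in> ?K" "\<phi> \<noteq> \<psi>"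
    then have "\<phi> \<in> extensional (carrier G)" "\<psi> \<in> extensional (carrier G)"
      by (auto simp: dual_group_def)
    with K obtain b where b: "b \<in> carrier G" "\<phi> b \<noteq> \<psi> b"
      using extensionalityI by blast
    have "?P (\<lambda>\<phi>. Re (\<phi> b))"
      using b trig_poly.add[OF trig_poly_evaluation[of b G "1/2"]
          trig_poly_evaluation[of "inv b" G "1/2"]]
      by (intro exI[of _ "\<lambda>\<phi>. 1/2 * \<phi> b + 1/2 * \<phi> (inv b)"])
         (auto simp: dual_group_inv_eq_cnj complex_eq_iff)
    moreover have "?P (\<lambda>\<phi>. Im (\<phi> b))"
      using b trig_poly.add[OF trig_poly_evaluation[of b G "- \<i>/2"]
          trig_poly_evaluation[of "inv b" G "\<i>/2"]]
      by (intro exI[of _ "\<lambda>\<phi>. - \<i>/2 * \<phi> b + \<i>/2 * \<phi> (inv b)"])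
         (auto simp: dual_group_inv_eq_cnj complex_eq_iff)
    moreover have "Re (\<phi> b) \<noteq> Re (\<psi> b) \<or> Im (\<phi> b) \<noteq> Im (\<psi> b)"
      using b complex_eq_iff by blast
    ultimately show "\<exists>g. ?P g \<and> g \<phi> \<noteq> g \<psi>"
      by (elim disjE) (rule exI, erule conjI, assumption)+
  qed (use assms in auto)
  then obtain g h where "trig_poly (dual_group G) h" "\<forall>\<phi>\<in>?K. h \<phi> = complex_of_real (g \<phi>)"
    "\<forall>\<phi>\<in>?K. \<bar>f \<phi> - g \<phi>\<bar> < e"
    by blast
  then show ?thesis
    by (intro that[of h]) (auto simp: abs_minus_commute norm_of_real simp flip: of_real_diff)
qed

section \<open>Automorphisms preserve Haar measure\<close>

locale dual_haar = comm_group B for B (structure) +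
  fixes \<mu> :: "('a \<Rightarrow> complex) measure"
  assumes haar: "normalized_haar_measure (dual_group B) (dual_topology B) \<mu>"
begin

abbreviation K where "K \<equiv> dual_group B"

sublocale K: comm_group K
  by (rule comm_group_dual_group) unfold_locales

lemma space_haar: "space \<mu> = carrier K"
  using haar by (simp add: normalized_haar_measure_def haar_measure_def topspace_dual_topology)

lemma sets_haar: "sets \<mu> = sets (restrict_space borel (carrier K))"
proof -
  have "sets \<mu> = sigma_sets (carrier K) {U. openin (top_of_set (carrier K)) U}"
    using haar unfolding normalized_haar_measure_def haar_measure_def dual_topology_eq_top_of_set
    by simp
  also have "{U. openin (top_of_set (carrier K)) U} = (\<inter>) (carrier K) ` {U. open U}"
    by (auto simp: openin_open)
  also have "sigma_sets (carrier K) \<dots> = (\<inter>) (carrier K) ` sigma_sets UNIV {U. open U}"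
  proof (rule sigma_sets_Int[symmetric])
    have "carrier K \<in> sets borel"
      by (simp add: closed_dual_group)
    then show "carrier K \<in> sigma_sets UNIV {U. open U}"
      by (simp add: borel_def)
  qed simp
  finally show ?thesis
    by (simp add: sets_restrict_space borel_def)
qed

lemma measurable_continuous:
  "continuous_on (carrier K) f \<Longrightarrow> f \<in> borel_measurable \<mu>"
  using borel_measurable_continuous_on_restrict[of "carrier K" f]
    measurable_cong_sets[OF sets_haar refl] by blast

lemma measurable_continuous_self:
  assumes "continuous_on (carrier K) T" "T \<in> carrier K \<rightarrow> carrier K"
  shows "T \<in> measurable \<mu> \<mu>"
proof -
  have "T \<in> measurable \<mu> (restrict_space borel (carrier K))"
    using assms by (intro measurable_restrict_space2 measurable_continuous) (simp_all add: space_haar)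
  then show ?thesis
    using measurable_cong_sets[OF refl sets_haar] by blast
qed

lemma emeasure_carrier: "emeasure \<mu> (carrier K) = 1"
  using haar space_haar by (simp add: normalized_haar_measure_def)

sublocale finite_measure \<mu>
  by standard (simp add: space_haar emeasure_carrier)

lemma integrable_continuous:
  fixes f :: "_ \<Rightarrow> 'c::{banach, second_countable_topology}"
  assumes "continuous_on (carrier K) f"
  shows "integrable \<mu> f"
proof -
  have "bounded (f ` carrier K)"
    by (intro compact_imp_bounded compact_continuous_image assms compact_dual_group)
  then obtain C where "\<And>\<phi>. \<phi> \<in> carrier K \<Longrightarrow> norm (f \<phi>) \<le> C"
    by (auto simp: bounded_iff)
  then show ?thesis
    by (intro integrable_const_bound[of _ C] measurable_continuous assms AE_I2) (simp add: space_haar)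
qed

lemma continuous_on_translation: "continuous_on (carrier K) (\<lambda>\<psi>. \<phi> \<otimes>\<^bsub>K\<^esub> \<psi>)"
proof (rule continuous_on_coordinatewise_then_product)
  show "continuous_on (carrier K) (\<lambda>\<psi>. (\<phi> \<otimes>\<^bsub>K\<^esub> \<psi>) b)" for b
    by (cases "b \<in> carrier B")
       (auto simp: dual_group_def intro!: continuous_intros continuous_on_evaluation)
qed

text \<open>
  The preimage of \<open>A\<close> under translation by \<open>\<phi>\<close> is the translate of \<open>A\<close> by the inverse of \<open>\<phi>\<close>.
\<close>

lemma distr_translation:
  assumes \<phi>: "\<phi> \<in> carrier K"
  shows "distr \<mu> \<mu> (\<lambda>\<psi>. \<phi> \<otimes>\<^bsub>K\<^esub> \<psi>) = \<mu>"
proof (rule measure_eqI)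
  have meas: "(\<lambda>\<psi>. \<phi> \<otimes>\<^bsub>K\<^esub> \<psi>) \<in> measurable \<mu> \<mu>"
    using \<phi> by (intro measurable_continuous_self continuous_on_translation) auto
  fix A assume "A \<in> sets (distr \<mu> \<mu> (\<lambda>\<psi>. \<phi> \<otimes>\<^bsub>K\<^esub> \<psi>))"
  then have A: "A \<in> sets \<mu>"
    by simp
  then have "A \<subseteq> carrier K"
    using sets.sets_into_space space_haar by blast
  then have "(\<lambda>\<psi>. \<phi> \<otimes>\<^bsub>K\<^esub> \<psi>) -` A \<inter> space \<mu> = inv\<^bsub>K\<^esub> \<phi> <#\<^bsub>K\<^esub> A"
    using \<phi> by (force simp: space_haar l_coset_def K.m_assoc[symmetric])
  with A \<phi> meas show "emeasure (distr \<mu> \<mu> (\<lambda>\<psi>. \<phi> \<otimes>\<^bsub>K\<^esub> \<psi>)) A = emeasure \<mu> A"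
    using haar by (simp add: emeasure_distr normalized_haar_measure_def haar_measure_def)
qed simp

text \<open>
  Translation by \<open>\<phi>\<close> multiplies the integral by \<open>\<xi> \<phi>\<close> and also leaves it unchanged, so the integral
  vanishes as soon as \<open>\<xi> \<phi> \<noteq> 1\<close> for some \<open>\<phi>\<close>.
\<close>

lemma integral_character:
  fixes \<xi> :: "_ \<Rightarrow> complex"
  assumes cont: "continuous_on (carrier K) \<xi>"
    and mult: "\<And>\<phi> \<psi>. \<lbrakk>\<phi> \<in> carrier K; \<psi> \<in> carrier K\<rbrakk> \<Longrightarrow> \<xi> (\<phi> \<otimes>\<^bsub>K\<^esub> \<psi>) = \<xi> \<phi> * \<xi> \<psi>"
  shows "integral\<^sup>L \<mu> \<xi> = (if \<forall>\<phi>\<in>carrier K. \<xi> \<phi> = 1 then 1 else 0)"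
proof (cases "\<forall>\<phi>\<in>carrier K. \<xi> \<phi> = 1")
  case True
  then have "integral\<^sup>L \<mu> \<xi> = integral\<^sup>L \<mu> (\<lambda>_. 1)"
    by (intro Bochner_Integration.integral_cong) (auto simp: space_haar)
  with True show ?thesis
    by (simp add: space_haar measure_def emeasure_carrier)
next
  case False
  then obtain \<phi> where \<phi>: "\<phi> \<in> carrier K" "\<xi> \<phi> \<noteq> 1"
    by blast
  have "integral\<^sup>L \<mu> \<xi> = integral\<^sup>L (distr \<mu> \<mu> (\<lambda>\<psi>. \<phi> \<otimes>\<^bsub>K\<^esub> \<psi>)) \<xi>"
    by (simp add: distr_translation \<phi>)
  also have "\<dots> = (\<integral>\<psi>. \<xi> (\<phi> \<otimes>\<^bsub>K\<^esub> \<psi>) \<partial>\<mu>)"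
    using \<phi> by (intro integral_distr measurable_continuous cont measurable_continuous_self
        continuous_on_translation) auto
  also have "\<dots> = (\<integral>\<psi>. \<xi> \<phi> * \<xi> \<psi> \<partial>\<mu>)"
    using \<phi> by (intro Bochner_Integration.integral_cong) (auto simp: space_haar mult)
  also have "\<dots> = \<xi> \<phi> * integral\<^sup>L \<mu> \<xi>"
    by simp
  finally show ?thesis
    using \<phi> False by simp
qed

lemma auto_dual_group_facts:
  assumes "T \<in> auto K"
  shows "T \<in> carrier K \<rightarrow> carrier K" "T ` carrier K = carrier K" "inj_on T (carrier K)"
    "\<And>\<phi> \<psi>. \<lbrakk>\<phi> \<in> carrier K; \<psi> \<in> carrier K\<rbrakk> \<Longrightarrow> T (\<phi> \<otimes>\<^bsub>K\<^esub> \<psi>) = T \<phi> \<otimes>\<^bsub>K\<^esub> T \<psi>"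
  using assms by (auto simp: auto_def Bij_def bij_betw_def hom_def)

text \<open>
  With \<open>\<xi>\<close> also \<open>\<xi> \<circ> T\<close> is a continuous character, and as \<open>T\<close> is onto, one is trivial if and only
  if the other is.
\<close>

lemma integral_trig_poly_auto:
  assumes T: "T \<in> auto K" "continuous_on (carrier K) T" and "trig_poly K f"
  shows "(\<integral>\<phi>. f (T \<phi>) \<partial>\<mu>) = integral\<^sup>L \<mu> f"
  using assms(3)
proof (induction rule: trig_poly.induct)
  case (character \<xi> c)
  note T' = auto_dual_group_facts[OF T(1)]
  have "(\<integral>\<phi>. \<xi> (T \<phi>) \<partial>\<mu>) = (if \<forall>\<phi>\<in>carrier K. \<xi> (T \<phi>) = 1 then 1 else 0)"
  proof (rule integral_character)
    show "continuous_on (carrier K) (\<lambda>\<phi>. \<xi> (T \<phi>))"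
      using T'(2) by (intro continuous_on_compose2[OF character(1) T(2)]) simp
    show "\<xi> (T (\<phi> \<otimes>\<^bsub>K\<^esub> \<psi>)) = \<xi> (T \<phi>) * \<xi> (T \<psi>)"
      if "\<phi> \<in> carrier K" "\<psi> \<in> carrier K" for \<phi> \<psi>
      using that T'(1) character(2) by (simp add: T'(4) Pi_iff)
  qed
  also have "(\<forall>\<phi>\<in>carrier K. \<xi> (T \<phi>) = 1) \<longleftrightarrow> (\<forall>\<phi>\<in>T ` carrier K. \<xi> \<phi> = 1)"
    by blast
  finally have "(\<integral>\<phi>. \<xi> (T \<phi>) \<partial>\<mu>) = integral\<^sup>L \<mu> \<xi>"
    using integral_character[OF character(1)] character(2) by (simp add: T'(2))
  then show ?case
    by simp
next
  case (add f g)
  have "integrable \<mu> (\<lambda>\<phi>. h (T \<phi>))" if "trig_poly K h" for h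
    using auto_dual_group_facts(2)[OF T(1)]
    by (intro integrable_continuous continuous_on_compose2[OF continuous_on_trig_poly[OF that] T(2)]) simp
  moreover have "integrable \<mu> h" if "trig_poly K h" for h
    by (intro integrable_continuous continuous_on_trig_poly that)
  ultimately show ?case
    using add by simp
qed

lemma integral_continuous_auto:
  fixes f :: "_ \<Rightarrow> real"
  assumes T: "T \<in> auto K" "continuous_on (carrier K) T" and f: "continuous_on (carrier K) f"
  shows "(\<integral>\<phi>. f (T \<phi>) \<partial>\<mu>) = integral\<^sup>L \<mu> f"
proof -
  have fT: "continuous_on (carrier K) (\<lambda>\<phi>. f (T \<phi>))"
    using auto_dual_group_facts(2)[OF T(1)] by (intro continuous_on_compose2[OF f T(2)]) simp
  let ?D = "complex_of_real (\<integral>\<phi>. f (T \<phi>) \<partial>\<mu>) - complex_of_real (integral\<^sup>L \<mu> f)"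
  have "norm ?D \<le> 0 + e" if "0 < e" for e
  proof -
    obtain h where h: "trig_poly K h"
      "\<And>\<phi>. \<phi> \<in> carrier K \<Longrightarrow> norm (h \<phi> - complex_of_real (f \<phi>)) < e / 2"
      using trig_poly_dense[OF f, of "e / 2"] \<open>0 < e\<close> by auto
    have hT: "continuous_on (carrier K) (\<lambda>\<phi>. h (T \<phi>))"
      using auto_dual_group_facts(2)[OF T(1)]
      by (intro continuous_on_compose2[OF continuous_on_trig_poly[OF h(1)] T(2)]) simp
    have close: "norm (integral\<^sup>L \<mu> g - complex_of_real (integral\<^sup>L \<mu> k)) \<le> e / 2"
      if "continuous_on (carrier K) g" "continuous_on (carrier K) k"
        "\<And>\<phi>. \<phi> \<in> carrier K \<Longrightarrow> norm (g \<phi> - complex_of_real (k \<phi>)) < e / 2" for g k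
    proof -
      have "integral\<^sup>L \<mu> g - complex_of_real (integral\<^sup>L \<mu> k)
          = (\<integral>\<phi>. g \<phi> - complex_of_real (k \<phi>) \<partial>\<mu>)"
        using that by (simp add: integrable_continuous)
      also have "norm \<dots> \<le> (\<integral>\<phi>. norm (g \<phi> - complex_of_real (k \<phi>)) \<partial>\<mu>)"
        by (rule integral_norm_bound)
      also have "\<dots> \<le> (\<integral>\<phi>. e / 2 \<partial>\<mu>)"
        using that by (intro integral_mono integrable_continuous continuous_intros)
          (auto simp: space_haar less_imp_le)
      finally show ?thesis
        by (simp add: space_haar measure_def emeasure_carrier)
    qed
    have "norm (integral\<^sup>L \<mu> h - complex_of_real (integral\<^sup>L \<mu> f)) \<le> e / 2"
      by (intro close continuous_on_trig_poly h f)
    moreover have "norm ((\<integral>\<phi>. h (T \<phi>) \<partial>\<mu>) - complex_of_real (\<integral>\<phi>. f (T \<phi>) \<partial>\<mu>)) \<le> e / 2"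
      using auto_dual_group_facts(1)[OF T(1)] by (intro close fT hT h) auto
    ultimately show ?thesis
      using integral_trig_poly_auto[OF T h(1)] norm_triangle_ineq4[of
          "integral\<^sup>L \<mu> h - complex_of_real (integral\<^sup>L \<mu> f)"
          "integral\<^sup>L \<mu> h - complex_of_real (\<integral>\<phi>. f (T \<phi>) \<partial>\<mu>)"]
      by simp
  qed
  then have "norm ?D \<le> 0"
    by (rule field_le_epsilon)
  then show ?thesis
    by simp
qed

lemma homeomorphic_map_continuous_auto:
  assumes "T \<in> auto K" "continuous_on (carrier K) T"
  shows "homeomorphic_map (dual_topology B) (dual_topology B) T"
  unfolding dual_topology_eq_top_of_set
proof (rule continuous_imp_homeomorphic_map)
  show "compact_space (top_of_set (carrier K))"
    by (simp add: compact_space_subtopology compact_dual_group)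
  show "Hausdorff_space (top_of_set (carrier K))"
    by (intro Hausdorff_space_subtopology Hausdorff_space_euclidean_fun)
qed (use assms auto_dual_group_facts[OF assms(1)] in auto)

lemma openin_in_sets: "openin (dual_topology B) U \<Longrightarrow> U \<in> sets \<mu>"
  using haar unfolding normalized_haar_measure_def haar_measure_def
  by (metis mem_Collect_eq sigma_sets.Basic)

lemma outer_regular:
  "A \<in> sets \<mu> \<Longrightarrow> emeasure \<mu> A = (INF U\<in>{U. openin (dual_topology B) U \<and> A \<subseteq> U}. emeasure \<mu> U)"
  using haar unfolding normalized_haar_measure_def haar_measure_def by blast

lemma inner_regular_open:
  "openin (dual_topology B) U \<Longrightarrow>
    emeasure \<mu> U = (SUP C\<in>{C. compactin (dual_topology B) C \<and> C \<subseteq> U}. emeasure \<mu> C)"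
  using haar unfolding normalized_haar_measure_def haar_measure_def by blast

text \<open>
  By inner regularity it suffices to bound the measure of a compact subset \<open>C\<close> of the preimage of
  \<open>U\<close>. A Urysohn function \<open>f\<close> between the indicators of \<open>T ` C\<close> and \<open>U\<close> does it:
  \<open>\<mu> C \<le> \<integral> f \<circ> T = \<integral> f \<le> \<mu> U\<close>.
\<close>

lemma emeasure_open_vimage_le:
  assumes T: "T \<in> auto K" "continuous_on (carrier K) T" and U: "openin (dual_topology B) U"
  shows "emeasure \<mu> (T -` U \<inter> carrier K) \<le> emeasure \<mu> U"
proof -
  let ?X = "dual_topology B"
  note T' = auto_dual_group_facts[OF T(1)]
  have contT: "continuous_map ?X ?X T"
    using homeomorphic_map_continuous_auto[OF T] by (rule homeomorphic_imp_continuous_map)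
  have X: "compact_space ?X" "Hausdorff_space ?X"
    by (simp_all add: dual_topology_eq_top_of_set compact_space_subtopology compact_dual_group
        Hausdorff_space_subtopology Hausdorff_space_euclidean_fun)
  have "{\<phi> \<in> topspace ?X. T \<phi> \<in> U} = T -` U \<inter> carrier K"
    by (auto simp: topspace_dual_topology)
  then have "openin ?X (T -` U \<inter> carrier K)"
    using openin_continuous_map_preimage[OF contT U] by simp
  then have "emeasure \<mu> (T -` U \<inter> carrier K)
      = (SUP C\<in>{C. compactin ?X C \<and> C \<subseteq> T -` U \<inter> carrier K}. emeasure \<mu> C)"
    by (rule inner_regular_open)
  also have "\<dots> \<le> emeasure \<mu> U"
  proof (rule SUP_least)
    fix C assume "C \<in> {C. compactin ?X C \<and> C \<subseteq> T -` U \<inter> carrier K}"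
    then have C: "compactin ?X C" "T ` C \<subseteq> U" "C \<subseteq> carrier K"
      by auto
    have U_sub: "U \<subseteq> topspace ?X"
      using U by (rule openin_subset)
    have "closedin ?X C"
      using C(1) X(2) by (rule compactin_imp_closedin[rotated])
    then have C_sets: "C \<in> sets \<mu>"
      using openin_in_sets[of "topspace ?X - C"] C(3) sets.compl_sets[of "topspace ?X - C" \<mu>]
      by (simp add: closedin_def topspace_dual_topology space_haar double_diff)
    have "closedin ?X (T ` C)"
      by (intro compactin_imp_closedin image_compactin[OF C(1) contT] X)
    then obtain f where f: "continuous_map ?X (top_of_set {0..1::real}) f"
      "f ` (topspace ?X - U) \<subseteq> {0}" "f ` (T ` C) \<subseteq> {1}"
      using Urysohn_lemma[of ?X "topspace ?X - U" "T ` C" 0 1] X U C(2)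
        compact_Hausdorff_or_regular_imp_normal_space[of ?X]
      by (auto simp: disjnt_def closedin_diff)
    have f01: "0 \<le> f \<phi>" "f \<phi> \<le> 1" if "\<phi> \<in> carrier K" for \<phi>
      using f(1) that by (auto simp: continuous_map_in_subtopology topspace_dual_topology)
    have contf: "continuous_on (carrier K) f"
      using f(1) by (simp add: continuous_map_in_subtopology dual_topology_eq_top_of_set)
    have "measure \<mu> C = (\<integral>\<phi>. indicator C \<phi> \<partial>\<mu>)"
      using C_sets C(3) by (simp add: space_haar Int_absorb2)
    also have "\<dots> \<le> (\<integral>\<phi>. f (T \<phi>) \<partial>\<mu>)"
    proof (rule integral_mono)
      show "integrable \<mu> (indicator C :: _ \<Rightarrow> real)"
        using C_sets by (simp add: integrable_indicator_iff less_top[symmetric])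
      show "integrable \<mu> (\<lambda>\<phi>. f (T \<phi>))"
        using T'(2) by (intro integrable_continuous continuous_on_compose2[OF contf T(2)]) simp
      show "indicator C \<phi> \<le> f (T \<phi>)" if "\<phi> \<in> space \<mu>" for \<phi>
        using that f(3) f01[of "T \<phi>"] T'(1)
        by (auto simp: space_haar indicator_def image_subset_iff Pi_iff)
    qed
    also have "\<dots> = integral\<^sup>L \<mu> f"
      by (rule integral_continuous_auto[OF T contf])
    also have "\<dots> \<le> (\<integral>\<phi>. indicator U \<phi> \<partial>\<mu>)"
    proof (rule integral_mono)
      show "integrable \<mu> (indicator U :: _ \<Rightarrow> real)"
        using openin_in_sets[OF U] by (simp add: integrable_indicator_iff less_top[symmetric])
      show "f \<phi> \<le> indicator U \<phi>" if "\<phi> \<in> space \<mu>" for \<phi>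
        using that f(2) f01[of \<phi>]
        by (auto simp: space_haar indicator_def image_subset_iff topspace_dual_topology)
    qed (rule integrable_continuous[OF contf])
    also have "\<dots> = measure \<mu> U"
      using U_sub by (simp add: space_haar topspace_dual_topology Int_absorb2)
    finally show "emeasure \<mu> C \<le> emeasure \<mu> U"
      by (simp add: emeasure_eq_measure)
  qed
  finally show ?thesis .
qed

lemma emeasure_vimage_le:
  assumes T: "T \<in> auto K" "continuous_on (carrier K) T" and A: "A \<in> sets \<mu>"
  shows "emeasure \<mu> (T -` A \<inter> carrier K) \<le> emeasure \<mu> A"
proof -
  have "emeasure \<mu> (T -` A \<inter> carrier K) \<le> emeasure \<mu> U"
    if U: "openin (dual_topology B) U" "A \<subseteq> U" for U
  proof -
    have "T -` U \<inter> carrier K \<in> sets \<mu>"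
      using measurable_sets[OF measurable_continuous_self[OF T(2)] openin_in_sets[OF U(1)]]
        auto_dual_group_facts(1)[OF T(1)] by (simp add: space_haar)
    then have "emeasure \<mu> (T -` A \<inter> carrier K) \<le> emeasure \<mu> (T -` U \<inter> carrier K)"
      using U by (intro emeasure_mono) auto
    also have "\<dots> \<le> emeasure \<mu> U"
      by (rule emeasure_open_vimage_le[OF T U(1)])
    finally show ?thesis .
  qed
  then have "emeasure \<mu> (T -` A \<inter> carrier K)
      \<le> (INF U\<in>{U. openin (dual_topology B) U \<and> A \<subseteq> U}. emeasure \<mu> U)"
    by (intro INF_greatest) auto
  also have "\<dots> = emeasure \<mu> A"
    using outer_regular[OF A] by simp
  finally show ?thesis .
qed

lemma inv_continuous_auto:
  assumes T: "T \<in> auto K" "continuous_on (carrier K) T"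
  shows "restrict (inv_into (carrier K) T) (carrier K) \<in> auto K"
    and "continuous_on (carrier K) (restrict (inv_into (carrier K) T) (carrier K))"
proof -
  show "restrict (inv_into (carrier K) T) (carrier K) \<in> auto K"
    using T(1) by (auto simp: auto_def restrict_inv_into_Bij K.restrict_inv_into_hom)
  obtain S where S: "homeomorphic_maps (dual_topology B) (dual_topology B) T S"
    using homeomorphic_map_continuous_auto[OF T] homeomorphic_map_maps by blast
  then have "continuous_on (carrier K) S"
    by (simp add: homeomorphic_maps_def dual_topology_eq_top_of_set)
  moreover have "S \<phi> = restrict (inv_into (carrier K) T) (carrier K) \<phi>" if "\<phi> \<in> carrier K" for \<phi>
  proof -
    have "T (inv_into (carrier K) T \<phi>) = \<phi>" "inv_into (carrier K) T \<phi> \<in> carrier K"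
      using that auto_dual_group_facts(2)[OF T(1)] by (simp_all add: f_inv_into_f inv_into_into)
    moreover have "S (T \<psi>) = \<psi>" if "\<psi> \<in> carrier K" for \<psi>
      using S that by (simp add: homeomorphic_maps_def topspace_dual_topology)
    ultimately show ?thesis
      using that by (metis restrict_apply')
  qed
  ultimately show "continuous_on (carrier K) (restrict (inv_into (carrier K) T) (carrier K))"
    by (rule continuous_on_eq)
qed

text \<open>
  The inequality \<open>emeasure_vimage_le\<close> holds for \<open>T\<close> and for its inverse, which gives equality.
\<close>

lemma distr_continuous_auto:
  assumes T: "T \<in> auto K" "continuous_on (carrier K) T"
  shows "distr \<mu> \<mu> T = \<mu>"
proof (rule measure_eqI)
  note T' = auto_dual_group_facts[OF T(1)]
  have meas: "T \<in> measurable \<mu> \<mu>"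
    by (intro measurable_continuous_self T T')
  fix A assume "A \<in> sets (distr \<mu> \<mu> T)"
  then have A: "A \<in> sets \<mu>"
    by simp
  let ?S = "restrict (inv_into (carrier K) T) (carrier K)"
  have TA: "T -` A \<inter> carrier K \<in> sets \<mu>"
    using measurable_sets[OF meas A] by (simp add: space_haar)
  have "?S -` (T -` A \<inter> carrier K) \<inter> carrier K = A"
    using sets.sets_into_space[OF A] T'(2)
    by (auto simp: space_haar f_inv_into_f inv_into_into)
  then have "emeasure \<mu> A \<le> emeasure \<mu> (T -` A \<inter> carrier K)"
    using emeasure_vimage_le[OF inv_continuous_auto[OF T] TA] by simp
  then show "emeasure (distr \<mu> \<mu> T) A = emeasure \<mu> A"
    using emeasure_vimage_le[OF T A] A meas by (simp add: emeasure_distr space_haar)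
qed simp

lemma subgroup_continuous_auto:
  "subgroup {T \<in> auto K. continuous_on (carrier K) T} (AutoGroup K)"
proof -
  interpret A: group "AutoGroup K"
    by (rule K.AutoGroup)
  have carr: "carrier (AutoGroup K) = auto K"
    by (simp add: AutoGroup_def)
  have mult: "S \<otimes>\<^bsub>AutoGroup K\<^esub> T = compose (carrier K) S T" if "S \<in> auto K" "T \<in> auto K" for S T
    using that by (auto simp: AutoGroup_def BijGroup_def auto_def)
  show ?thesis
  proof (rule A.subgroupI)
    show "{T \<in> auto K. continuous_on (carrier K) T} \<noteq> {}"
      using K.id_in_auto by (force intro: continuous_on_eq[OF continuous_on_id])
  next
    fix T assume "T \<in> {T \<in> auto K. continuous_on (carrier K) T}"
    then have T: "T \<in> auto K" "continuous_on (carrier K) T"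
      by auto
    have "inv\<^bsub>AutoGroup K\<^esub> T = restrict (inv_into (carrier K) T) (carrier K)"
    proof (rule A.inv_equality)
      have "compose (carrier K) (restrict (inv_into (carrier K) T) (carrier K)) T
          = (\<lambda>\<phi>\<in>carrier K. \<phi>)"
        using T(1) by (intro Bij_compose_restrict_eq) (simp add: auto_def)
      then show "restrict (inv_into (carrier K) T) (carrier K) \<otimes>\<^bsub>AutoGroup K\<^esub> T
          = \<one>\<^bsub>AutoGroup K\<^esub>"
        using mult[OF inv_continuous_auto(1)[OF T] T(1)] by (simp add: AutoGroup_def BijGroup_def)
    qed (use T inv_continuous_auto(1)[OF T] carr in auto)
    then show "inv\<^bsub>AutoGroup K\<^esub> T \<in> {T \<in> auto K. continuous_on (carrier K) T}"
      using inv_continuous_auto[OF T] by simp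
  next
    fix S T
    assume "S \<in> {T \<in> auto K. continuous_on (carrier K) T}" "T \<in> {T \<in> auto K. continuous_on (carrier K) T}"
    then have ST: "S \<in> auto K" "continuous_on (carrier K) S" "T \<in> auto K" "continuous_on (carrier K) T"
      by auto
    have "continuous_on (carrier K) (\<lambda>\<phi>. S (T \<phi>))"
      using auto_dual_group_facts(2)[OF ST(3)] by (intro continuous_on_compose2[OF ST(2,4)]) simp
    then have "continuous_on (carrier K) (compose (carrier K) S T)"
      by (rule continuous_on_eq) (simp add: compose_def)
    then show "S \<otimes>\<^bsub>AutoGroup K\<^esub> T \<in> {T \<in> auto K. continuous_on (carrier K) T}"
      using ST A.m_closed[of S T] carr by (simp add: mult)
  qed (auto simp: carr)
qed

end

section \<open>Free orbits have no measurable transversal\<close>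

text \<open>
  The sets \<open>{x. g k x \<in> D}\<close> are almost everywhere disjoint, cover the space up to a null set, and
  have equal measure. Infinitely many sets of equal measure cannot do this in a finite measure space
  of positive mass.
\<close>

lemma (in finite_measure) no_measurable_transversal:
  fixes g :: "'i::countable \<Rightarrow> 'a \<Rightarrow> 'a"
  assumes "infinite (UNIV :: 'i set)" and "emeasure M (space M) \<noteq> 0"
    and meas: "\<And>k. g k \<in> measurable M M"
    and pres: "\<And>k. distr M M (g k) = M"
    and free: "AE x in M. inj (\<lambda>k. g k x)"
    and D: "D \<in> sets (completion M)"
  shows "\<not> (AE x in M. \<exists>!y. y \<in> D \<inter> range (\<lambda>k. g k x))"
proof
  assume trans: "AE x in M. \<exists>!y. y \<in> D \<inter> range (\<lambda>k. g k x)"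
  have AE_orbit: "AE x in M. \<forall>k. P (g k x)" if "AE x in M. P x" for P
    unfolding AE_all_countable
  proof
    fix k
    have "AE x in distr M M (g k). P x"
      using that unfolding pres .
    then show "AE x in M. P (g k x)"
      by (rule AE_distrD[OF meas])
  qed
  \<comment> \<open>A set of the completion is replaced by a measurable one: as there are only countably many maps,
    almost every orbit avoids the null set in which the two may differ.\<close>
  obtain S N N' where D: "D = S \<union> N" "N \<subseteq> N'" "N' \<in> null_sets M" "S \<in> sets M"
    using D by (rule sets_completionE)
  have unique: "AE x in M. \<exists>!k. g k x \<in> S"
    using trans free AE_orbit[OF AE_not_in[OF D(3)]]
  proof eventually_elim
    case (elim x)
    then have "g k x \<in> D \<longleftrightarrow> g k x \<in> S" for k
      using D(1,2) by blast
    with elim show ?case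
      by (metis (no_types, lifting) Int_iff injD rangeE rangeI)
  qed
  show False
  proof (cases "measure M S = 0")
    case True
    then have "S \<in> null_sets M"
      using D(4) by (simp add: emeasure_eq_measure null_sets_def)
    from unique AE_orbit[OF AE_not_in[OF this]] have "AE x in M. False"
      by eventually_elim blast
    then show False
      using assms(2) by (simp add: eventually_False ae_filter_eq_bot_iff)
  next
    case False
    \<comment> \<open>\<open>n\<close> disjoint copies of \<open>S\<close> would be too large for the space.\<close>
    then obtain n where n: "measure M (space M) < real n * measure M S"
      using reals_Archimedean3[of "measure M S"] zero_less_measure_iff by blast
    obtain F :: "'i set" where F: "finite F" "card F = n"
      using infinite_arbitrarily_large[OF assms(1)] by blast
    have ind: "(\<lambda>x. indicator S (g k x) :: ennreal) \<in> borel_measurable M" for k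
      using D(4) by (intro measurable_compose[OF meas]) simp
    have "of_nat n * emeasure M S = (\<Sum>k\<in>F. \<integral>\<^sup>+x. indicator S x \<partial>distr M M (g k))"
      using F D(4) by (simp add: pres)
    also have "\<dots> = (\<Sum>k\<in>F. \<integral>\<^sup>+x. indicator S (g k x) \<partial>M)"
      using D(4) by (intro sum.cong refl nn_integral_distr meas) simp
    also have "\<dots> = (\<integral>\<^sup>+x. (\<Sum>k\<in>F. indicator S (g k x)) \<partial>M)"
      by (rule nn_integral_sum[symmetric]) (rule ind)
    also have "\<dots> \<le> (\<integral>\<^sup>+x. 1 \<partial>M)"
    proof (rule nn_integral_mono_AE)
      show "AE x in M. (\<Sum>k\<in>F. indicator S (g k x)) \<le> (1::ennreal)"
        using unique
      proof eventually_elim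
        case (elim x)
        define k where "k = (THE k. g k x \<in> S)"
        have k: "g j x \<notin> S" if "j \<noteq> k" for j
          using the1_equality[OF elim, of j] that by (auto simp: k_def)
        have "(\<Sum>j\<in>F. indicator S (g j x)) \<le> (\<Sum>j\<in>F. if j = k then 1 else (0::ennreal))"
          using k by (intro sum_mono) (auto simp: indicator_def)
        also have "\<dots> \<le> 1"
          using F(1) by (simp add: sum.delta)
        finally show ?case .
      qed
    qed
    finally have "ennreal (real n * measure M S) \<le> ennreal (measure M (space M))"
      by (simp add: emeasure_eq_measure ennreal_mult ennreal_of_nat_eq_real_of_nat)
    with n show False
      by simp
  qed
qed

theorem proposition4p15:
  fixes B :: "('a, 'm) monoid_scheme"
    and \<alpha> :: "'a \<Rightarrow> 'a"
    and \<mu> :: "('a \<Rightarrow> complex) measure"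
  assumes "comm_group B"
    and "\<alpha> \<in> auto B"
    and "normalized_haar_measure (dual_group B) (dual_topology B) \<mu>"
    and "periodic_points (dual_group B) (dual_aut B \<alpha>) \<in> null_sets \<mu>"
  shows "\<not> (\<exists>M \<in> sets (completion \<mu>).
            AE \<phi> in \<mu>. \<exists>!\<psi>. \<psi> \<in> M \<inter> aut_orbit (dual_group B) (dual_aut B \<alpha>) \<phi>)"
proof -
  interpret comm_group B by fact
  interpret dual_haar B \<mu> by unfold_locales fact
  interpret A: group "AutoGroup K"
    by (rule K.AutoGroup)
  let ?T = "dual_aut B \<alpha>"
  define g where "g = (\<lambda>k::int. ?T [^]\<^bsub>AutoGroup K\<^esub> k)"
  have T: "?T \<in> auto K"
    by (rule dual_aut_in_auto) fact+
  have "continuous_on (carrier K) ?T"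
  proof (rule continuous_on_coordinatewise_then_product)
    fix b
    have "continuous_on (carrier K) (\<lambda>\<phi>. if b \<in> carrier B then \<phi> (\<alpha> b) else undefined)"
      by (cases "b \<in> carrier B") (simp_all add: continuous_on_evaluation)
    then show "continuous_on (carrier K) (\<lambda>\<phi>. ?T \<phi> b)"
      by (rule continuous_on_eq) (simp add: dual_aut_def)
  qed
  then have g: "g k \<in> auto K" "continuous_on (carrier K) (g k)" for k
    using A.subgroup_int_pow_closed[OF subgroup_continuous_auto, of ?T k] T by (auto simp: g_def)
  have g_add: "g (j + k) \<phi> = g j (g k \<phi>)" if "\<phi> \<in> carrier K" for j k \<phi>
  proof -
    have "g (j + k) = g j \<otimes>\<^bsub>AutoGroup K\<^esub> g k"
      using T unfolding g_def by (intro A.int_pow_mult) (simp add: AutoGroup_def)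
    also have "\<dots> = compose (carrier K) (g j) (g k)"
      using g(1)[of j] g(1)[of k] by (auto simp: AutoGroup_def BijGroup_def auto_def)
    finally show ?thesis
      using that by (simp add: compose_def)
  qed
  have g_0: "g 0 \<phi> = \<phi>" if "\<phi> \<in> carrier K" for \<phi>
    using that by (simp add: g_def AutoGroup_def BijGroup_def)
  have closed: "g k \<phi> \<in> carrier K" if "\<phi> \<in> carrier K" for k \<phi>
    using that auto_dual_group_facts(1)[OF g(1)[of k]] by blast
  \<comment> \<open>A repetition in the orbit of a point at the times \<open>j < k\<close> is moved back to time 0, so that the
    point itself is periodic, of period \<open>k - j\<close>.\<close>
  have periodic: "\<phi> \<in> periodic_points K ?T" if "\<phi> \<in> carrier K" "g j \<phi> = g k \<phi>" "j < k" for j k \<phi>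
  proof -
    have "g (k - j) \<phi> = g (- j) (g k \<phi>)"
      using g_add[OF that(1), of "- j" k] by simp
    also have "\<dots> = g (- j) (g j \<phi>)"
      by (simp add: that(2))
    also have "\<dots> = \<phi>"
      using g_add[OF that(1), of "- j" j] that(1) by (simp add: g_0)
    finally show ?thesis
      using that(1,3) by (auto simp: periodic_points_def g_def intro!: exI[of _ "k - j"])
  qed
  have "AE \<phi> in \<mu>. inj (\<lambda>k. g k \<phi>)"
    using AE_not_in[OF assms(4)] AE_space
  proof eventually_elim
    case (elim \<phi>)
    then show ?case
      using periodic[of \<phi>] by (intro injI) (metis linorder_neqE space_haar)
  qed
  moreover have "aut_orbit K ?T \<phi> = range (\<lambda>k. g k \<phi>)" for \<phi>
    by (auto simp: aut_orbit_def g_def)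
  moreover have "g k \<in> measurable \<mu> \<mu>" for k
    by (intro measurable_continuous_self g auto_dual_group_facts(1))
  moreover have "distr \<mu> \<mu> (g k) = \<mu>" for k
    by (intro distr_continuous_auto g)
  ultimately show ?thesis
    using no_measurable_transversal[of g] by (auto simp: infinite_UNIV_int space_haar emeasure_carrier)
qed

end
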